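(* Let $\omega$ be the posterior edge-weight matrix defined in the context, let $\Delta$ be its Laplacian, and let $u \in V$. Let $Q = (Q_{kl})_{k,l\in V}$ be defined by $Q_{kl} = \left[(\Delta^{\{u\}})^{-1}\right]_{kl}$ if $k,l \neq u$ and $Q_{kl} = 0$ otherwise. Put $M_{kl} = Q_{kk} + Q_{ll} - 2Q_{kl}$, $M_{k,l_1,l_2} = Q_{kk} + Q_{l_1 l_2} - Q_{k l_1} - Q_{k l_2}$ and $M^{(k)}_{l_1 l_2} = M_{k l_1} M_{k l_2} - M_{k,l_1,l_2}^2$. For $k \in V$, let $N_k$ denote the degree of vertex $k$ in the random tree $T^*$, where $T^*$ is distributed according to the posterior distribution $\xi(\cdot|D)$ on spanning trees, and let $\mathbf{E}[N_k|D]$ and $\mathbf{V}(N_k|D)$ denote the mean and the variance of $N_k$ under this posterior distribution. Then, for all $k \in V$, $$\mathbf{V}(N_k|D) = \mathbf{E}[N_k|D]\left(1 - \mathbf{E}[N_k|D]\right) + \sum_{\substack{l_1 \neq k,\ l_2 \neq k \\ l_1 \neq l_2}} \omega_{k l_1}\,\omega_{k l_2}\, M^{(k)}_{l_1 l_2},$$ where the sum runs over ordered pairs $(l_1,l_2)$ of distinct elements of $V\setminus\{k\}$.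
   Context: Let $V = \{1,\dots,p\}$, let $\mathcal{T}$ be the set of spanning trees on $V$ (connected acyclic undirected graphs with vertex set $V$), and write $E_T$ for the edge set of $T\in\mathcal{T}$. Prior on trees: $\beta = (\beta_{ij})$ is a symmetric matrix with non-negative entries such that the graph on $V$ with edge set $\{\{i,j\} : i \neq j,\ \beta_{ij} > 0\}$ is connected, and $\xi(T) = \frac{1}{Z_0}\prod_{\{i,j\}\in E_T}\beta_{ij}$ for $T \in \mathcal{T}$, with $Z_0$ a normalising constant. Marginal likelihood: $D$ is the observed data, $D_i$ its restriction to variable $i\in V$. There are positive numbers $p(D_i)$ ($i \in V$) and $p(D_i,D_j) = p(D_j,D_i)$ ($i\neq j$) not depending on $T$ such that the marginal likelihood of $D$ given the tree $T$ is $$p(D|T) = \prod_{i\in V} p(D_i)\prod_{\{i,j\}\in E_T}\frac{p(D_i,D_j)}{p(D_i)p(D_j)}.$$ Posterior weights: $\omega_{ij} = \beta_{ij}\,\dfrac{p(D_i,D_j)}{p(D_i)p(D_j)}$ for $i\neq j$, and $\omega_{ii} = 0$. By Bayes' rule the posterior distribution on trees is $\xi(T|D) = \frac{1}{Z}\prod_{\{i,j\}\in E_T}\omega_{ij}$, with $Z = \sum_{T\in\mathcal{T}}\prod_{\{i,j\}\in E_T}\omega_{ij}$. Laplacian: $\Delta = (\Delta_{ij})_{i,j\in V}$ with $\Delta_{ij} = -\omega_{ij}$ if $i\neq j$ and $\Delta_{ii} = \sum_{j\in V}\omega_{ij}$. For $U\subseteq V$, $\Delta^U$ is the matrix obtained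 from $\Delta$ by removing the rows and columns indexed by $U$, its rows and columns remaining indexed by $V\setminus U$. The matrix $\Delta^{\{u\}}$ is invertible. *)

theory Defs
  imports "HOL-Probability.Probability"
begin

section \<open>Spanning trees\<close>

text \<open>
  A simple undirected graph on a fixed vertex set \<open>V\<close> is identified with its set of edges, an edge
  being a two-element subset of \<open>V\<close>.
\<close>

definition all_edges :: "'a set \<Rightarrow> 'a set set" where
  "all_edges V = {{i, j} | i j. i \<in> V \<and> j \<in> V \<and> i \<noteq> j}"

definition graph_connected :: "'a set \<Rightarrow> 'a set set \<Rightarrow> bool" where
  "graph_connected V E \<longleftrightarrow> (\<forall>i\<in>V. \<forall>j\<in>V. (i, j) \<in> {(a, b). {a, b} \<in> E}\<^sup>*)"

text \<open>A cycle is given by the list of its vertices, the last one being adjacent to the first.\<close>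

definition graph_cycle :: "'a set set \<Rightarrow> 'a list \<Rightarrow> bool" where
  "graph_cycle E c \<longleftrightarrow> length c \<ge> 3 \<and> distinct c \<and>
     (\<forall>i<length c. {c ! i, c ! (Suc i mod length c)} \<in> E)"

definition graph_acyclic :: "'a set set \<Rightarrow> bool" where
  "graph_acyclic E \<longleftrightarrow> (\<nexists>c. graph_cycle E c)"

definition spanning_trees :: "'a set \<Rightarrow> 'a set set set" where
  "spanning_trees V = {T. T \<subseteq> all_edges V \<and> graph_connected V T \<and> graph_acyclic T}"

definition vertex_degree :: "'a set set \<Rightarrow> 'a \<Rightarrow> nat" where
  "vertex_degree T k = card {e \<in> T. k \<in> e}"

text \<open>
  \<open>edge_prod w E\<close> is the product of \<open>w i j\<close> over the unordered pairs \<open>{i, j} \<in> E\<close>. It is only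
  meaningful for \<open>w\<close> symmetric; the order on the vertices merely selects one of the two equal
  values \<open>w i j\<close> and \<open>w j i\<close>.
\<close>

definition edge_prod :: "('a::linorder \<Rightarrow> 'a \<Rightarrow> real) \<Rightarrow> 'a set set \<Rightarrow> real" where
  "edge_prod w E = (\<Prod>e\<in>E. w (Min e) (Max e))"

section \<open>Prior, marginal likelihood and posterior\<close>

text \<open>
  Throughout, \<open>\<beta>\<close> is the matrix of prior edge weights, \<open>pD i\<close> stands for $p(D_i)$ and \<open>pDD i j\<close>
  for $p(D_i, D_j)$.
\<close>

definition tree_prior :: "'a::linorder set \<Rightarrow> ('a \<Rightarrow> 'a \<Rightarrow> real) \<Rightarrow> 'a set set \<Rightarrow> real" where
  "tree_prior V \<beta> T = edge_prod \<beta> T / (\<Sum>T'\<in>spanning_trees V. edge_prod \<beta> T')"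

definition marginal_likelihood ::
  "'a::linorder set \<Rightarrow> ('a \<Rightarrow> real) \<Rightarrow> ('a \<Rightarrow> 'a \<Rightarrow> real) \<Rightarrow> 'a set set \<Rightarrow> real" where
  "marginal_likelihood V pD pDD T =
     (\<Prod>i\<in>V. pD i) * edge_prod (\<lambda>i j. pDD i j / (pD i * pD j)) T"

text \<open>Bayes' rule; the product form of the posterior is \<open>tree_posterior_eq\<close> below.\<close>

definition tree_posterior ::
  "'a::linorder set \<Rightarrow> ('a \<Rightarrow> 'a \<Rightarrow> real) \<Rightarrow> ('a \<Rightarrow> real) \<Rightarrow> ('a \<Rightarrow> 'a \<Rightarrow> real) \<Rightarrow> 'a set set \<Rightarrow> real"
where
  "tree_posterior V \<beta> pD pDD T =
     tree_prior V \<beta> T * marginal_likelihood V pD pDD T /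
     (\<Sum>T'\<in>spanning_trees V. tree_prior V \<beta> T' * marginal_likelihood V pD pDD T')"

text \<open>
  The law of the random tree. That \<open>embed_pmf\<close> is applied to a genuine probability mass function is
  shown in \<open>pmf_posterior_tree\<close> below.
\<close>

definition posterior_tree ::
  "'a::linorder set \<Rightarrow> ('a \<Rightarrow> 'a \<Rightarrow> real) \<Rightarrow> ('a \<Rightarrow> real) \<Rightarrow> ('a \<Rightarrow> 'a \<Rightarrow> real) \<Rightarrow> 'a set set pmf"
where
  "posterior_tree V \<beta> pD pDD =
     embed_pmf (\<lambda>T. if T \<in> spanning_trees V then tree_posterior V \<beta> pD pDD T else 0)"

definition posterior_weight ::
  "('a \<Rightarrow> 'a \<Rightarrow> real) \<Rightarrow> ('a \<Rightarrow> real) \<Rightarrow> ('a \<Rightarrow> 'a \<Rightarrow> real) \<Rightarrow> 'a \<Rightarrow> 'a \<Rightarrow> real" where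
  "posterior_weight \<beta> pD pDD i j = (if i = j then 0 else \<beta> i j * (pDD i j / (pD i * pD j)))"

section \<open>Laplacian and its reduced inverse\<close>

definition laplacian :: "'a set \<Rightarrow> ('a \<Rightarrow> 'a \<Rightarrow> real) \<Rightarrow> 'a \<Rightarrow> 'a \<Rightarrow> real" where
  "laplacian V w i j = (if i = j then (\<Sum>l\<in>V. w i l) else - w i j)"

text \<open>
  Square matrices with rows and columns indexed by a finite set \<open>I\<close> are functions of two arguments of
  which only the values on \<open>I \<times> I\<close> matter, so that removing the rows and columns in \<open>U\<close> from a
  matrix indexed by \<open>V\<close> just means regarding it as indexed by \<open>V - U\<close>. The definition of the inverse
  mirrors that of \<^const>\<open>matrix_inv\<close>.
\<close>

definition is_inverse_on :: "'a set \<Rightarrow> ('a \<Rightarrow> 'a \<Rightarrow> real) \<Rightarrow> ('a \<Rightarrow> 'a \<Rightarrow> real) \<Rightarrow> bool" where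
  "is_inverse_on I A B \<longleftrightarrow>
     (\<forall>i\<in>I. \<forall>j\<in>I. (\<Sum>l\<in>I. A i l * B l j) = (if i = j then 1 else 0)) \<and>
     (\<forall>i\<in>I. \<forall>j\<in>I. (\<Sum>l\<in>I. B i l * A l j) = (if i = j then 1 else 0))"

definition matrix_inv_on :: "'a set \<Rightarrow> ('a \<Rightarrow> 'a \<Rightarrow> real) \<Rightarrow> 'a \<Rightarrow> 'a \<Rightarrow> real" where
  "matrix_inv_on I A = (SOME B. is_inverse_on I A B)"

definition Qmat :: "'a set \<Rightarrow> ('a \<Rightarrow> 'a \<Rightarrow> real) \<Rightarrow> 'a \<Rightarrow> 'a \<Rightarrow> 'a \<Rightarrow> real" where
  "Qmat V w u k l =
     (if k \<in> V - {u} \<and> l \<in> V - {u} then matrix_inv_on (V - {u}) (laplacian V w) k l else 0)"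

definition M2 :: "('a \<Rightarrow> 'a \<Rightarrow> real) \<Rightarrow> 'a \<Rightarrow> 'a \<Rightarrow> real" where
  "M2 Q k l = Q k k + Q l l - 2 * Q k l"

definition M3 :: "('a \<Rightarrow> 'a \<Rightarrow> real) \<Rightarrow> 'a \<Rightarrow> 'a \<Rightarrow> 'a \<Rightarrow> real" where
  "M3 Q k l1 l2 = Q k k + Q l1 l2 - Q k l1 - Q k l2"

definition Mk :: "('a \<Rightarrow> 'a \<Rightarrow> real) \<Rightarrow> 'a \<Rightarrow> 'a \<Rightarrow> 'a \<Rightarrow> real" where
  "Mk Q k l1 l2 = M2 Q k l1 * M2 Q k l2 - (M3 Q k l1 l2)\<^sup>2"

section \<open>The posterior is a probability distribution on trees\<close>

lemma finite_all_edges: "finite V \<Longrightarrow> finite (all_edges V)"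
  by (rule finite_subset[of _ "Pow V"]) (auto simp: all_edges_def)

lemma finite_spanning_trees: "finite V \<Longrightarrow> finite (spanning_trees V)"
  by (rule finite_subset[of _ "Pow (all_edges V)"]) (auto simp: spanning_trees_def finite_all_edges)

lemma all_edges_MinMax:
  assumes "e \<in> all_edges (V :: 'a::linorder set)"
  shows "Min e \<in> V" "Max e \<in> V" "Min e \<noteq> Max e" "e = {Min e, Max e}"
proof -
  obtain i j where "e = {i, j}" "i \<in> V" "j \<in> V" "i \<noteq> j"
    using assms by (auto simp: all_edges_def)
  thus "Min e \<in> V" "Max e \<in> V" "Min e \<noteq> Max e" "e = {Min e, Max e}"
    by (cases "i < j"; auto simp: min_def max_def)+
qed

lemma edge_prod_posterior_weight:
  assumes "T \<in> spanning_trees V"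
  shows "edge_prod (posterior_weight \<beta> pD pDD) T =
           edge_prod \<beta> T * edge_prod (\<lambda>i j. pDD i j / (pD i * pD j)) T"
  unfolding edge_prod_def prod.distrib[symmetric]
proof (rule prod.cong)
  fix e assume "e \<in> T"
  hence "Min e \<noteq> Max e" using assms all_edges_MinMax(3)[of e V] by (auto simp: spanning_trees_def)
  thus "posterior_weight \<beta> pD pDD (Min e) (Max e) =
      \<beta> (Min e) (Max e) * (pDD (Min e) (Max e) / (pD (Min e) * pD (Max e)))"
    by (simp add: posterior_weight_def)
qed simp

lemma spanning_tree_exists:
  assumes "finite E" "E \<subseteq> all_edges V" "graph_connected V E"
  shows "\<exists>T\<in>spanning_trees V. T \<subseteq> E"
proof -
  let ?C = "{F. F \<subseteq> E \<and> graph_connected V F}"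
  have "finite ?C" "?C \<noteq> {}" using assms by auto
  then obtain T where T: "T \<in> ?C" and min: "\<And>F. F \<in> ?C \<Longrightarrow> F \<subseteq> T \<Longrightarrow> F = T"
    using finite_has_minimal[of ?C] by metis
  have "graph_acyclic T"
    unfolding graph_acyclic_def
  proof
    assume "\<exists>c. graph_cycle T c"
    then obtain c where len: "length c \<ge> 3" and dist: "distinct c"
      and adj: "\<And>i. i < length c \<Longrightarrow> {c ! i, c ! (Suc i mod length c)} \<in> T"
      by (auto simp: graph_cycle_def)
    define n where "n = length c - 1"
    have n: "length c = Suc n" "n \<ge> 2" using len by (auto simp: n_def)
    define e where "e = {c ! n, c ! 0}"
    define R where "R = {(a, b). {a, b} \<in> T - {e}}"
    have "sym R" by (auto simp: R_def sym_def insert_commute)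
    hence symR: "sym (R\<^sup>*)" by (rule sym_rtrancl)
    have path: "(c ! 0, c ! i) \<in> R\<^sup>*" if "i \<le> n" for i
      using that
    proof (induction i)
      case (Suc i)
      have "{c ! i, c ! Suc i} \<in> T" using adj[of i] Suc.prems n by simp
      moreover have "{c ! i, c ! Suc i} \<noteq> e"
      proof
        assume eq: "{c ! i, c ! Suc i} = e"
        have inj: "c ! a = c ! b \<Longrightarrow> a = b" if "a \<le> n" "b \<le> n" for a b
          using dist that n by (simp add: nth_eq_iff_index_eq)
        have "(c ! i = c ! n \<and> c ! Suc i = c ! 0) \<or> (c ! i = c ! 0 \<and> c ! Suc i = c ! n)"
          using eq by (auto simp: e_def doubleton_eq_iff)
        thus False using inj[of i n] inj[of "Suc i" 0] inj[of i 0] inj[of "Suc i" n] Suc.prems n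
          by auto
      qed
      ultimately have "(c ! i, c ! Suc i) \<in> R" by (simp add: R_def)
      thus ?case using Suc by (meson Suc_leD rtrancl.rtrancl_into_rtrancl)
    qed simp
    have p: "(c ! 0, c ! n) \<in> R\<^sup>*" "(c ! n, c ! 0) \<in> R\<^sup>*"
      using path[of n] symD[OF symR] by auto
    have "{(a, b). {a, b} \<in> T} \<subseteq> R\<^sup>*"
    proof clarify
      fix a b assume ab: "{a, b} \<in> T"
      show "(a, b) \<in> R\<^sup>*"
      proof (cases "{a, b} = e")
        case True
        thus ?thesis using p by (auto simp: e_def doubleton_eq_iff)
      next
        case False
        thus ?thesis using ab by (auto simp: R_def)
      qed
    qed
    hence "{(a, b). {a, b} \<in> T}\<^sup>* \<subseteq> R\<^sup>*" by (metis rtrancl_idemp rtrancl_mono)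
    hence "graph_connected V (T - {e})" using T by (auto simp: graph_connected_def R_def)
    hence "T - {e} = T" using T by (intro min) auto
    moreover have "e \<in> T" using adj[of n] n by (simp add: e_def)
    ultimately show False by blast
  qed
  thus ?thesis using T assms by (auto simp: spanning_trees_def)
qed

context
  fixes V :: "'a::linorder set" and \<beta> :: "'a \<Rightarrow> 'a \<Rightarrow> real"
    and pD :: "'a \<Rightarrow> real" and pDD :: "'a \<Rightarrow> 'a \<Rightarrow> real"
  assumes finite_V: "finite V"
    and \<beta>_sym: "\<forall>i\<in>V. \<forall>j\<in>V. \<beta> i j = \<beta> j i"
    and \<beta>_nonneg: "\<forall>i\<in>V. \<forall>j\<in>V. \<beta> i j \<ge> 0"
    and \<beta>_connected: "graph_connected V {{i, j} | i j. i \<in> V \<and> j \<in> V \<and> i \<noteq> j \<and> \<beta> i j > 0}"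
    and pD_pos: "\<forall>i\<in>V. pD i > 0"
    and pDD_pos: "\<forall>i\<in>V. \<forall>j\<in>V. i \<noteq> j \<longrightarrow> pDD i j > 0"
begin

lemma edge_prod_prior_nonneg:
  assumes "T \<in> spanning_trees V" shows "edge_prod \<beta> T \<ge> 0"
  unfolding edge_prod_def
proof (rule prod_nonneg)
  fix e assume "e \<in> T"
  hence "e \<in> all_edges V" using assms by (auto simp: spanning_trees_def)
  thus "0 \<le> \<beta> (Min e) (Max e)" using all_edges_MinMax(1,2)[of e V] \<beta>_nonneg by blast
qed

lemma edge_prod_ratio_pos:
  assumes "T \<in> spanning_trees V"
  shows "edge_prod (\<lambda>i j. pDD i j / (pD i * pD j)) T > 0"
  unfolding edge_prod_def
proof (rule prod_pos)
  fix e assume "e \<in> T"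
  hence "e \<in> all_edges V" using assms by (auto simp: spanning_trees_def)
  thus "0 < pDD (Min e) (Max e) / (pD (Min e) * pD (Max e))"
    using all_edges_MinMax(1,2,3)[of e V] pD_pos pDD_pos by simp
qed

lemma edge_prod_weight_nonneg:
  "T \<in> spanning_trees V \<Longrightarrow> edge_prod (posterior_weight \<beta> pD pDD) T \<ge> 0"
  using edge_prod_prior_nonneg[of T] edge_prod_ratio_pos[of T]
  by (simp add: edge_prod_posterior_weight)

lemma positive_tree_exists: "\<exists>T\<in>spanning_trees V. edge_prod \<beta> T > 0"
proof -
  define E where "E = {{i, j} | i j. i \<in> V \<and> j \<in> V \<and> i \<noteq> j \<and> \<beta> i j > 0}"
  have sub: "E \<subseteq> all_edges V" by (auto simp: E_def all_edges_def)
  have "finite E" using finite_subset[OF sub finite_all_edges[OF finite_V]] .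
  moreover have "graph_connected V E" using \<beta>_connected by (simp only: E_def)
  ultimately obtain T where T: "T \<in> spanning_trees V" "T \<subseteq> E"
    using spanning_tree_exists[OF _ sub] by metis
  have "edge_prod \<beta> T > 0"
    unfolding edge_prod_def
  proof (rule prod_pos)
    fix e assume "e \<in> T"
    hence "e \<in> E" using T(2) by auto
    then obtain i j where e: "e = {i, j}" "i \<in> V" "j \<in> V" "\<beta> i j > 0" by (auto simp: E_def)
    moreover have "\<beta> j i = \<beta> i j" using e \<beta>_sym by blast
    ultimately show "0 < \<beta> (Min e) (Max e)" by (simp add: min_def max_def)
  qed
  thus ?thesis using T by blast
qed

lemma sum_edge_prod_pos:
  "(\<Sum>T\<in>spanning_trees V. edge_prod \<beta> T) > 0"
  "(\<Sum>T\<in>spanning_trees V. edge_prod (posterior_weight \<beta> pD pDD) T) > 0"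
proof -
  obtain T where T: "T \<in> spanning_trees V" "edge_prod \<beta> T > 0"
    using positive_tree_exists by blast
  show "(\<Sum>T\<in>spanning_trees V. edge_prod \<beta> T) > 0"
    using T edge_prod_prior_nonneg finite_spanning_trees[OF finite_V] by (intro sum_pos2)
  have "edge_prod (posterior_weight \<beta> pD pDD) T > 0"
    using T edge_prod_ratio_pos[of T] by (simp add: edge_prod_posterior_weight)
  thus "(\<Sum>T\<in>spanning_trees V. edge_prod (posterior_weight \<beta> pD pDD) T) > 0"
    using T edge_prod_weight_nonneg finite_spanning_trees[OF finite_V] by (intro sum_pos2)
qed

theorem tree_posterior_eq:
  assumes "T \<in> spanning_trees V"
  shows "tree_posterior V \<beta> pD pDD T =
    edge_prod (posterior_weight \<beta> pD pDD) T /
    (\<Sum>T'\<in>spanning_trees V. edge_prod (posterior_weight \<beta> pD pDD) T')"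
proof -
  let ?W = "edge_prod (posterior_weight \<beta> pD pDD)"
  define Z0 where "Z0 = (\<Sum>T'\<in>spanning_trees V. edge_prod \<beta> T')"
  define c where "c = (\<Prod>i\<in>V. pD i) / Z0"
  have "(\<Prod>i\<in>V. pD i) > 0" using pD_pos by (intro prod_pos) auto
  hence c: "c > 0" using sum_edge_prod_pos(1) by (simp add: c_def Z0_def)
  have eq: "tree_prior V \<beta> S * marginal_likelihood V pD pDD S = c * ?W S"
    if "S \<in> spanning_trees V" for S
    using edge_prod_posterior_weight[OF that, of \<beta> pD pDD]
    by (simp add: tree_prior_def marginal_likelihood_def c_def Z0_def)
  have "tree_posterior V \<beta> pD pDD T = c * ?W T / (c * (\<Sum>T'\<in>spanning_trees V. ?W T'))"
    unfolding tree_posterior_def sum_distrib_left using eq assms by (simp cong: sum.cong)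
  thus ?thesis using c by simp
qed

theorem pmf_posterior_tree:
  "pmf (posterior_tree V \<beta> pD pDD) T =
     (if T \<in> spanning_trees V then tree_posterior V \<beta> pD pDD T else 0)"
proof -
  let ?f = "\<lambda>T. if T \<in> spanning_trees V then tree_posterior V \<beta> pD pDD T else 0"
  let ?S = "spanning_trees V"
  have nonneg: "?f S \<ge> 0" for S
    using edge_prod_weight_nonneg[of S] sum_edge_prod_pos(2) by (simp add: tree_posterior_eq)
  have "(\<integral>\<^sup>+S. ennreal (?f S) \<partial>count_space UNIV) = (\<Sum>S\<in>?S. ennreal (?f S))"
    by (rule nn_integral_count_space'[OF finite_spanning_trees[OF finite_V]]) auto
  also have "\<dots> = ennreal (\<Sum>S\<in>?S. ?f S)" using nonneg by (intro sum_ennreal)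
  also have "(\<Sum>S\<in>?S. ?f S) = 1"
    using sum_edge_prod_pos(2) by (simp add: tree_posterior_eq flip: sum_divide_distrib)
  finally have "(\<integral>\<^sup>+S. ennreal (?f S) \<partial>count_space UNIV) = 1" by simp
  thus ?thesis unfolding posterior_tree_def using nonneg by (intro pmf_embed_pmf)
qed

end

end

theory Submission
  imports Defs
begin

text \<open>
  A spanning tree rooted at \<open>k\<close> is the same as a parent function on \<open>V - {k}\<close> whose orbits all end in
  \<open>k\<close>, and the degree of \<open>k\<close> is the number of vertices with parent \<open>k\<close>. More generally let \<open>F S\<close> be
  the weighted number of spanning forests with root set \<open>S\<close>, and \<open>X S b a\<close> the part of \<open>F (insert a S)\<close>
  where \<open>b\<close> lies in the component of \<open>a\<close>. Choosing a new parent for one vertex shows that \<open>X S / F S\<close>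
  inverts the Laplacian with the rows and columns in \<open>S\<close> removed, so that \<open>F (insert a S) / F S\<close> is a
  diagonal entry of this inverse. The trees containing the edges \<open>{k, l1}\<close> and \<open>{k, l2}\<close> are, without these edges,
  the forests with root set \<open>{k, l1, l2}\<close>; adding these two roots one after the other gives the probability of the
  two edges as a \<open>2 \<times> 2\<close> minor of the inverse Laplacian grounded at \<open>k\<close>, whose entries are the
  numbers \<open>M3 Q k l1 l2\<close>. The variance follows by expanding the square of the degree.
\<close>

section \<open>Rooted forests as parent functions\<close>

text \<open>\<open>r\<close> is the first vertex of \<open>S\<close> on the orbit of
  \<open>i\<close>. Being inductive, the relation fails for orbits that never reach
  \<open>S\<close>, and it ignores the values of \<open>g\<close> on \<open>S\<close>, so one
  function serves several root sets.\<close>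

inductive leads :: "'a set \<Rightarrow> ('a \<Rightarrow> 'a) \<Rightarrow> 'a \<Rightarrow> 'a \<Rightarrow> bool" for S g where
  root: "r \<in> S \<Longrightarrow> leads S g r r"
| step: "i \<notin> S \<Longrightarrow> leads S g (g i) r \<Longrightarrow> leads S g i r"

lemma leads_root_iff: "i \<in> S \<Longrightarrow> leads S g i r \<longleftrightarrow> r = i"
  by (auto intro: leads.root elim: leads.cases)

lemma leads_step_iff: "i \<notin> S \<Longrightarrow> leads S g i r \<longleftrightarrow> leads S g (g i) r"
  by (auto intro: leads.step elim: leads.cases)

lemma leads_in: "leads S g i r \<Longrightarrow> r \<in> S"
  by (induction rule: leads.induct) auto

lemma leads_unique: "leads S g i r \<Longrightarrow> leads S g i r' \<Longrightarrow> r = r'"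
  by (induction rule: leads.induct) (auto simp: leads_root_iff leads_step_iff)

text \<open>Up to its first visit to \<open>insert a S\<close> an orbit never uses the value at
  \<open>a\<close>, so redirecting \<open>a\<close> matters only from \<open>r'\<close> on.\<close>

lemma leads_extend_compose:
  assumes "leads (insert a S) g i r'"
  shows "leads S (g(a := j)) i r \<longleftrightarrow> leads S (g(a := j)) r' r"
  using assms by (induction rule: leads.induct) (auto simp: leads_step_iff)

text \<open>If \<open>j\<close> leads to \<open>a\<close>, the new edge from \<open>a\<close> to
  \<open>j\<close> closes a cycle, and no orbit that runs into this cycle reaches
  \<open>S\<close>.\<close>

lemma leads_extend_not_to:
  assumes "leads S (g(a := j)) i r" "a \<notin> S" "leads (insert a S) g j a"
  shows "\<not> leads (insert a S) g i a"
  using assms(1)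
proof (induction rule: leads.induct)
  case (root r)
  thus ?case using assms(2) by (auto simp: leads_root_iff)
next
  case (step i r)
  thus ?case using assms(3) by (cases "i = a") (auto simp: leads_step_iff)
qed

lemma leads_restrict:
  assumes "leads S f i r"
  shows "\<exists>r'. leads (insert a S) (f(a := y)) i r'"
  using assms
proof (induction rule: leads.induct)
  case (step i r)
  then obtain r' where "leads (insert a S) (f(a := y)) (f i) r'" by blast
  with step.hyps show ?case
    by (cases "i = a") (auto simp: leads_root_iff leads_step_iff simp del: fun_upd_apply simp: fun_upd_other)
qed (auto intro: leads.root)

text \<open>Taking \<open>d\<close> as the number of steps to \<open>S\<close> turns later arguments
  about cycles into comparisons of natural numbers.\<close>

lemma leads_decreasing:
  obtains d :: "'a \<Rightarrow> nat" where "\<And>i r. leads S g i r \<Longrightarrow> i \<notin> S \<Longrightarrow> d (g i) < d i"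
proof -
  define d where "d i = (LEAST n. (g ^^ n) i \<in> S)" for i
  have "d (g i) < d i" if "leads S g i r" "i \<notin> S" for i r
  proof -
    from that(1) have "\<exists>n. (g ^^ n) i \<in> S"
    proof (induction rule: leads.induct)
      case (root r)
      thus ?case by (intro exI[of _ 0]) simp
    next
      case (step i r)
      then obtain n where "(g ^^ n) (g i) \<in> S" by blast
      thus ?case by (intro exI[of _ "Suc n"]) (simp add: funpow_swap1)
    qed
    hence di: "(g ^^ d i) i \<in> S" unfolding d_def by (rule LeastI_ex)
    with that(2) obtain m where m: "d i = Suc m" by (cases "d i") auto
    with di have "(g ^^ m) (g i) \<in> S" by (simp add: funpow_swap1)
    hence "d (g i) \<le> m" unfolding d_def by (rule Least_le)
    thus ?thesis using m by simp
  qed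
  thus ?thesis using that by blast
qed

text \<open>
  A spanning forest of \<open>V\<close> with exactly one root in \<open>S\<close> per component is encoded by the function that
  maps every vertex outside \<open>S\<close> to its parent.
\<close>

definition forests :: "'a set \<Rightarrow> 'a set \<Rightarrow> ('a \<Rightarrow> 'a) set" where
  "forests V S = {g \<in> (V - S) \<rightarrow>\<^sub>E V. \<forall>i\<in>V. \<exists>r. leads S g i r}"

lemma finite_forests: "finite V \<Longrightarrow> finite (forests V S)"
  by (rule finite_subset[of _ "(V - S) \<rightarrow>\<^sub>E V"]) (auto simp: forests_def intro: finite_PiE)

lemma forests_leads: "g \<in> forests V S \<Longrightarrow> i \<in> V \<Longrightarrow> \<exists>r. leads S g i r"
  by (auto simp: forests_def)

lemma forests_in: "g \<in> forests V S \<Longrightarrow> i \<in> V \<Longrightarrow> i \<notin> S \<Longrightarrow> g i \<in> V"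
  by (auto simp: forests_def)

text \<open>The new edge attaches the whole component of \<open>a\<close> to the component of
  \<open>j\<close>; all other vertices keep their roots.\<close>

lemma leads_extend_iff:
  assumes "g \<in> forests V (insert a S)" "a \<notin> S" "i \<in> V" "j \<in> V" "\<not> leads (insert a S) g j a"
  shows "leads S (g(a := j)) i r \<longleftrightarrow>
    leads (insert a S) g i r \<and> r \<noteq> a \<or> leads (insert a S) g i a \<and> leads (insert a S) g j r"
proof -
  have *: "leads S (g(a := j)) i r \<longleftrightarrow> leads (insert a S) g i r" if na: "\<not> leads (insert a S) g i a" and i: "i \<in> V" for i
  proof -
    obtain r' where r': "leads (insert a S) g i r'" using forests_leads[OF assms(1) i] ..
    with na have "r' \<in> S" using leads_in[OF r'] by auto
    hence "leads S (g(a := j)) i r \<longleftrightarrow> r = r'"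
      using leads_extend_compose[OF r', of j r] by (simp add: leads_root_iff)
    thus ?thesis using r' leads_unique[OF r'] by blast
  qed
  show ?thesis
  proof (cases "leads (insert a S) g i a")
    case True
    have "leads S (g(a := j)) i r \<longleftrightarrow> leads S (g(a := j)) j r"
      using leads_extend_compose[OF True, of j r] leads_step_iff[OF assms(2), of "g(a := j)" r]
      by simp
    thus ?thesis using True *[OF assms(5,4)] leads_unique[OF True, of r] by blast
  next
    case False
    thus ?thesis using *[OF False assms(3)] by blast
  qed
qed

lemma forests_extend_iff:
  assumes "g \<in> forests V (insert a S)" "a \<in> V" "a \<notin> S" "j \<in> V"
  shows "g(a := j) \<in> forests V S \<longleftrightarrow> \<not> leads (insert a S) g j a"
proof
  assume f: "g(a := j) \<in> forests V S"
  show "\<not> leads (insert a S) g j a"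
  proof
    assume l: "leads (insert a S) g j a"
    obtain r where "leads S (g(a := j)) a r" using forests_leads[OF f] assms by blast
    from leads_extend_not_to[OF this assms(3) l] show False by (auto intro: leads.root)
  qed
next
  assume n: "\<not> leads (insert a S) g j a"
  have "\<exists>r. leads S (g(a := j)) i r" if i: "i \<in> V" for i
  proof -
    obtain r1 r2 where "leads (insert a S) g i r1" "leads (insert a S) g j r2"
      using forests_leads[OF assms(1) i] forests_leads[OF assms(1,4)] by blast
    thus ?thesis using leads_extend_iff[OF assms(1,3) i assms(4) n] by blast
  qed
  moreover have "g(a := j) \<in> (V - S) \<rightarrow>\<^sub>E V"
    using assms by (auto simp: forests_def PiE_def extensional_def Pi_def)
  ultimately show "g(a := j) \<in> forests V S" by (auto simp: forests_def)
qed

lemma forests_restrict: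
  assumes "f \<in> forests V S" "a \<in> V" "a \<notin> S"
  shows "f(a := undefined) \<in> forests V (insert a S)"
proof -
  have "f(a := undefined) \<in> (V - insert a S) \<rightarrow>\<^sub>E V"
    using assms(1) by (auto simp: forests_def PiE_def extensional_def Pi_def)
  thus ?thesis
    using assms(1) leads_restrict[of S f _ _ a undefined] unfolding forests_def by blast
qed

text \<open>Cutting the edge from \<open>a\<close> to its parent is invertible: \<open>f\<close> is
  recovered from the remaining forest and the old parent, which may be any vertex outside the
  component of \<open>a\<close>.\<close>

lemma sum_forests_extend:
  fixes \<phi> :: "('a \<Rightarrow> 'a) \<Rightarrow> real"
  assumes "finite V" "a \<in> V" "a \<notin> S"
  shows "(\<Sum>f\<in>forests V S. \<phi> f) =
    (\<Sum>g\<in>forests V (insert a S). \<Sum>j\<in>V. of_bool (\<not> leads (insert a S) g j a) * \<phi> (g(a := j)))"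
proof -
  let ?F = "forests V (insert a S)"
  have "(\<Sum>g\<in>?F. \<Sum>j\<in>V. of_bool (\<not> leads (insert a S) g j a) * \<phi> (g(a := j))) =
    (\<Sum>g\<in>?F. \<Sum>j | j \<in> V \<and> \<not> leads (insert a S) g j a. \<phi> (g(a := j)))"
    using assms by (intro sum.cong refl sum.mono_neutral_cong_right) auto
  also have "\<dots> = (\<Sum>(g, j) \<in> (SIGMA g:?F. {j \<in> V. \<not> leads (insert a S) g j a}). \<phi> (g(a := j)))"
    using assms finite_forests[of V "insert a S"] by (intro sum.Sigma) auto
  also have "\<dots> = (\<Sum>f\<in>forests V S. \<phi> f)"
  proof (rule sum.reindex_bij_witness[of _ "\<lambda>f. (f(a := undefined), f a)" "\<lambda>(g, j). g(a := j)"])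
    fix x assume x: "x \<in> (SIGMA g:?F. {j \<in> V. \<not> leads (insert a S) g j a})"
    obtain g j where gj: "x = (g, j)" by (cases x)
    \<comment> \<open>The inverse map resets the value at \<open>a\<close> to
      \<open>undefined\<close>; extensionality already gives \<open>g\<close> this value at the new
      root \<open>a\<close>.\<close>
    have "g a = undefined" using x gj by (auto simp: forests_def)
    thus "(\<lambda>f. (f(a := undefined), f a)) ((\<lambda>(g, j). g(a := j)) x) = x" using gj by auto
    show "(\<lambda>(g, j). g(a := j)) x \<in> forests V S"
      using x gj assms forests_extend_iff[of g V a S j] by auto
  next
    fix f assume f: "f \<in> forests V S"
    show "(\<lambda>(g, j). g(a := j)) (f(a := undefined), f a) = f" by simp
    have g: "f(a := undefined) \<in> ?F" using f assms(2,3) by (rule forests_restrict)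
    have "f a \<in> V" using f assms(2,3) by (rule forests_in)
    thus "(f(a := undefined), f a) \<in> (SIGMA g:?F. {j \<in> V. \<not> leads (insert a S) g j a})"
      using g forests_extend_iff[OF g assms(2,3), of "f a"] f by simp
  qed auto
  finally show ?thesis ..
qed

text \<open>A root \<open>r\<close> leads only to itself, so it is always an admissible parent of
  \<open>a\<close>. This removes a prescribed edge from a sum over forests.\<close>

lemma sum_forests_fixed_parent:
  fixes \<phi> :: "('a \<Rightarrow> 'a) \<Rightarrow> real"
  assumes "finite V" "a \<in> V" "a \<notin> S" "r \<in> S" "r \<in> V"
  shows "(\<Sum>f\<in>forests V S. of_bool (f a = r) * \<phi> f) =
    (\<Sum>g\<in>forests V (insert a S). \<phi> (g(a := r)))"
proof -
  have "(\<Sum>f\<in>forests V S. of_bool (f a = r) * \<phi> f) =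
    (\<Sum>g\<in>forests V (insert a S). \<Sum>j\<in>V. of_bool (\<not> leads (insert a S) g j a) * (of_bool (j = r) * \<phi> (g(a := j))))"
    using sum_forests_extend[OF assms(1-3), of "\<lambda>f. of_bool (f a = r) * \<phi> f"] by simp
  also have "\<dots> = (\<Sum>g\<in>forests V (insert a S). \<Sum>j\<in>V. if j = r then \<phi> (g(a := j)) else 0)"
    using assms by (intro sum.cong refl) (auto simp: leads_root_iff)
  also have "\<dots> = (\<Sum>g\<in>forests V (insert a S). \<phi> (g(a := r)))"
    using assms by (simp add: sum.delta)
  finally show ?thesis .
qed

section \<open>Weighted forest sums and their recurrences\<close>

definition forest_weight :: "'a set \<Rightarrow> ('a \<Rightarrow> 'a \<Rightarrow> real) \<Rightarrow> 'a set \<Rightarrow> ('a \<Rightarrow> 'a) \<Rightarrow> real" where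
  "forest_weight V w S g = (\<Prod>i\<in>V - S. w i (g i))"

definition forest_sum :: "'a set \<Rightarrow> ('a \<Rightarrow> 'a \<Rightarrow> real) \<Rightarrow> 'a set \<Rightarrow> real" where
  "forest_sum V w S = (\<Sum>g\<in>forests V S. forest_weight V w S g)"

text \<open>The root \<open>a\<close> is kept apart from \<open>S\<close> so that, for fixed
  \<open>S\<close>, the two vertices index a matrix over \<open>V - S\<close>, like the Laplacian
  with \<open>S\<close> removed.\<close>

definition forest_sum_to :: "'a set \<Rightarrow> ('a \<Rightarrow> 'a \<Rightarrow> real) \<Rightarrow> 'a set \<Rightarrow> 'a \<Rightarrow> 'a \<Rightarrow> real" where
  "forest_sum_to V w S b a = (\<Sum>g\<in>forests V (insert a S).
     of_bool (leads (insert a S) g b a) * forest_weight V w (insert a S) g)"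

lemma forest_weight_extend:
  assumes "finite V" "a \<in> V" "a \<notin> S"
  shows "forest_weight V w S (g(a := j)) = w a j * forest_weight V w (insert a S) g"
proof -
  have "V - S = insert a (V - insert a S)" using assms by auto
  hence "forest_weight V w S (g(a := j)) =
    (\<Prod>i\<in>insert a (V - insert a S). w i ((g(a := j)) i))" by (simp only: forest_weight_def)
  also have "\<dots> = w a j * (\<Prod>i\<in>V - insert a S. w i ((g(a := j)) i))"
    using assms by (subst prod.insert) auto
  also have "(\<Prod>i\<in>V - insert a S. w i ((g(a := j)) i)) = forest_weight V w (insert a S) g"
    unfolding forest_weight_def by (intro prod.cong) auto
  finally show ?thesis .
qed

lemma forest_sum_to_self: "forest_sum_to V w S a a = forest_sum V w (insert a S)"
  by (simp add: forest_sum_to_def forest_sum_def leads_root_iff)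

lemma forest_sum_to_root: "a \<notin> S \<Longrightarrow> b \<in> S \<Longrightarrow> forest_sum_to V w S b a = 0"
  by (auto simp: forest_sum_to_def leads_root_iff intro!: sum.neutral)

text \<open>Give the root \<open>a\<close> an arbitrary parent \<open>j\<close>. Either
  \<open>j\<close> lies in the component of \<open>a\<close>, which \<open>forest_sum_to\<close>
  counts, or the edge produces a forest with root set \<open>S\<close>.\<close>

lemma forest_sum_recurrence:
  assumes "finite V" "a \<in> V" "a \<notin> S"
  shows "(\<Sum>j\<in>V. w a j) * forest_sum V w (insert a S) =
    (\<Sum>j\<in>V. w a j * forest_sum_to V w S j a) + forest_sum V w S"
proof -
  let ?F = "forests V (insert a S)" and ?x = "forest_weight V w (insert a S)"
  let ?l = "\<lambda>g j. leads (insert a S) g j a"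
  have "forest_sum V w S = (\<Sum>g\<in>?F. \<Sum>j\<in>V. of_bool (\<not> ?l g j) * (w a j * ?x g))"
    unfolding forest_sum_def
    by (subst sum_forests_extend[OF assms]) (simp only: forest_weight_extend[OF assms])
  moreover have "(\<Sum>j\<in>V. w a j * forest_sum_to V w S j a) =
      (\<Sum>g\<in>?F. \<Sum>j\<in>V. of_bool (?l g j) * (w a j * ?x g))"
    unfolding forest_sum_to_def sum_distrib_left
    by (subst sum.swap) (simp add: mult_ac)
  moreover have "(\<Sum>j\<in>V. w a j) * forest_sum V w (insert a S) =
      (\<Sum>g\<in>?F. \<Sum>j\<in>V. w a j * ?x g)"
    unfolding forest_sum_def by (simp add: sum_distrib_left sum_distrib_right)
  moreover have "(\<Sum>g\<in>?F. \<Sum>j\<in>V. w a j * ?x g) =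
      (\<Sum>g\<in>?F. \<Sum>j\<in>V. of_bool (?l g j) * (w a j * ?x g)) +
      (\<Sum>g\<in>?F. \<Sum>j\<in>V. of_bool (\<not> ?l g j) * (w a j * ?x g))"
    unfolding sum.distrib[symmetric] by (intro sum.cong refl) auto
  ultimately show ?thesis by simp
qed

text \<open>
  Cut the edge from \<open>b\<close> to its parent \<open>i\<close> and pair the remaining forest with a second choice \<open>j\<close> of a
  parent of \<open>b\<close>; up to exchanging \<open>i\<close> and \<open>j\<close>, both sides sum over the same triples.
\<close>

lemma forest_sum_to_harmonic:
  assumes "finite V" "a \<in> V" "b \<in> V" "a \<notin> S" "b \<notin> S" "a \<noteq> b"
  shows "(\<Sum>j\<in>V. w b j) * forest_sum_to V w S b a = (\<Sum>j\<in>V. w b j * forest_sum_to V w S j a)"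
proof -
  let ?S' = "insert a S"
  let ?S = "insert b ?S'"
  let ?F = "forests V ?S" and ?x = "forest_weight V w ?S"
  let ?A = "\<lambda>g i. of_bool (leads ?S g i a) :: real" and ?B = "\<lambda>g i. of_bool (leads ?S g i b) :: real"
  have b: "b \<notin> ?S'" using assms by auto
  \<comment> \<open>Here \<open>i\<close> is the parent of \<open>b\<close>: the factor
    \<open>1 - ?B g i\<close> rules out a cycle, and \<open>j\<close> leads to \<open>a\<close>
    either directly or through \<open>b\<close> and then \<open>i\<close>.\<close>
  have to: "forest_sum_to V w S j a =
      (\<Sum>g\<in>?F. \<Sum>i\<in>V. (1 - ?B g i) * (?A g j + ?B g j * ?A g i) * (w b i * ?x g))" if "j \<in> V" for j
    unfolding forest_sum_to_def
    unfolding sum_forests_extend[OF assms(1,3) b] forest_weight_extend[OF assms(1,3) b]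
  proof (intro sum.cong refl)
    fix g i assume gi: "g \<in> ?F" "i \<in> V"
    have "of_bool (leads ?S' (g(b := i)) j a) = ?A g j + ?B g j * ?A g i" if "\<not> leads ?S g i b"
      using leads_extend_iff[OF gi(1) b \<open>j \<in> V\<close> gi(2) that, of a] leads_unique[of ?S g j a b] assms(6)
      by auto
    thus "of_bool (\<not> leads ?S g i b) * (of_bool (leads ?S' (g(b := i)) j a) * (w b i * ?x g)) =
      (1 - ?B g i) * (?A g j + ?B g j * ?A g i) * (w b i * ?x g)"
      by (cases "leads ?S g i b") simp_all
  qed
  \<comment> \<open>For \<open>j = b\<close> only the passage through \<open>b\<close> remains, and
    \<open>?A g i\<close> already excludes \<open>?B g i\<close> because roots are unique.\<close>
  have tob: "forest_sum_to V w S b a = (\<Sum>g\<in>?F. \<Sum>i\<in>V. ?A g i * (w b i * ?x g))"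
    unfolding to[OF assms(3)]
    using assms leads_unique[of ?S _ _ a b]
    by (intro sum.cong refl) (auto simp: leads_root_iff)
  have "(\<Sum>j\<in>V. w b j * forest_sum_to V w S j a) =
     (\<Sum>g\<in>?F. \<Sum>j\<in>V. \<Sum>i\<in>V. w b j * ((1 - ?B g i) * (?A g j + ?B g j * ?A g i) * (w b i * ?x g)))"
    by (simp add: to sum_distrib_left sum.swap[of _ ?F])
  also have "\<dots> = (\<Sum>g\<in>?F. \<Sum>j\<in>V. \<Sum>i\<in>V. w b j * (?A g i * (w b i * ?x g)))"
  proof (rule sum.cong[OF refl])
    fix g
    \<comment> \<open>In the expansion the terms with \<open>?A g i * ?B g i\<close> vanish. The two
      \<open>?q\<close> terms differ by exchanging \<open>i\<close> and \<open>j\<close> and cancel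
      after summation, which leaves \<open>?p\<close>.\<close>
    let ?p = "\<lambda>j i. w b j * w b i * ?x g * ?A g j" and ?q = "\<lambda>j i. w b j * w b i * ?x g * (?A g j * ?B g i)"
    have AB: "?A g i * ?B g i = 0" for i using leads_unique[of ?S g i a b] assms(6) by auto
    have "(\<Sum>j\<in>V. \<Sum>i\<in>V. w b j * ((1 - ?B g i) * (?A g j + ?B g j * ?A g i) * (w b i * ?x g))) =
       (\<Sum>j\<in>V. \<Sum>i\<in>V. ?p j i - ?q j i + ?q i j - w b j * w b i * ?x g * ?B g j * (?A g i * ?B g i))"
      by (intro sum.cong refl) (simp only: algebra_simps)
    also have "\<dots> = (\<Sum>j\<in>V. \<Sum>i\<in>V. ?p j i) - (\<Sum>j\<in>V. \<Sum>i\<in>V. ?q j i) + (\<Sum>j\<in>V. \<Sum>i\<in>V. ?q i j)"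
      unfolding AB by (simp only: mult_zero_right diff_zero sum.distrib sum_subtractf)
    also have "(\<Sum>j\<in>V. \<Sum>i\<in>V. ?q i j) = (\<Sum>j\<in>V. \<Sum>i\<in>V. ?q j i)" by (rule sum.swap)
    also have "(\<Sum>j\<in>V. \<Sum>i\<in>V. ?p j i) = (\<Sum>j\<in>V. \<Sum>i\<in>V. ?p i j)" by (rule sum.swap)
    also have "\<dots> = (\<Sum>j\<in>V. \<Sum>i\<in>V. w b j * (?A g i * (w b i * ?x g)))"
      by (intro sum.cong refl) (simp only: mult_ac)
    finally show "(\<Sum>j\<in>V. \<Sum>i\<in>V. w b j * ((1 - ?B g i) * (?A g j + ?B g j * ?A g i) * (w b i * ?x g))) =
      (\<Sum>j\<in>V. \<Sum>i\<in>V. w b j * (?A g i * (w b i * ?x g)))" by simp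
  qed
  also have "\<dots> = (\<Sum>j\<in>V. w b j) * forest_sum_to V w S b a"
    unfolding tob by (simp only: sum_product sum_distrib_left[of _ _ ?F])
  finally show ?thesis ..
qed

section \<open>Inverting the reduced Laplacian\<close>

text \<open>Associativity: \<open>C = (B A) C = B (A C) = B\<close>, written out in entries.\<close>

lemma left_inverse_eq_right_inverse:
  fixes A B C :: "'a \<Rightarrow> 'a \<Rightarrow> real"
  assumes I: "finite I"
    and B: "\<And>i j. i \<in> I \<Longrightarrow> j \<in> I \<Longrightarrow> (\<Sum>l\<in>I. B i l * A l j) = (if i = j then 1 else 0)"
    and C: "\<And>i j. i \<in> I \<Longrightarrow> j \<in> I \<Longrightarrow> (\<Sum>l\<in>I. A i l * C l j) = (if i = j then 1 else 0)"
    and ij: "i \<in> I" "j \<in> I"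
  shows "C i j = B i j"
proof -
  have "C i j = (\<Sum>m\<in>I. (if i = m then 1 else 0) * C m j)"
    using I ij by (simp add: if_distrib[of "\<lambda>x. x * _"] cong: if_cong)
  also have "\<dots> = (\<Sum>m\<in>I. (\<Sum>l\<in>I. B i l * A l m) * C m j)"
    using ij by (intro sum.cong refl) (simp add: B)
  also have "\<dots> = (\<Sum>l\<in>I. B i l * (\<Sum>m\<in>I. A l m * C m j))"
    unfolding sum_distrib_left sum_distrib_right by (subst sum.swap) (simp only: mult.assoc)
  also have "\<dots> = (\<Sum>l\<in>I. B i l * (if l = j then 1 else 0))"
    using ij by (intro sum.cong refl) (simp add: C)
  also have "\<dots> = B i j"
    using I ij by (simp add: if_distrib[of "\<lambda>x. _ * x"] cong: if_cong)
  finally show ?thesis .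
qed

lemma is_inverse_on_unique:
  assumes "finite I" "is_inverse_on I A B"
    and C: "\<And>i j. i \<in> I \<Longrightarrow> j \<in> I \<Longrightarrow> (\<Sum>l\<in>I. A i l * C l j) = (if i = j then 1 else 0)"
    and "i \<in> I" "j \<in> I"
  shows "C i j = B i j"
proof (rule left_inverse_eq_right_inverse[OF assms(1) _ C assms(4,5)])
  fix i j assume "i \<in> I" "j \<in> I"
  thus "(\<Sum>l\<in>I. B i l * A l j) = (if i = j then 1 else 0)"
    using assms(2) by (auto simp: is_inverse_on_def)
qed

text \<open>Transposing \<open>A B = 1\<close> makes the transpose of \<open>B\<close> a left
  inverse of the symmetric \<open>A\<close>, and left and right inverses agree.\<close>

lemma right_inverse_symmetric:
  fixes A B :: "'a \<Rightarrow> 'a \<Rightarrow> real"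
  assumes I: "finite I"
    and sym: "\<And>i j. i \<in> I \<Longrightarrow> j \<in> I \<Longrightarrow> A i j = A j i"
    and B: "\<And>i j. i \<in> I \<Longrightarrow> j \<in> I \<Longrightarrow> (\<Sum>l\<in>I. A i l * B l j) = (if i = j then 1 else 0)"
    and ij: "i \<in> I" "j \<in> I"
  shows "B i j = B j i"
proof (rule left_inverse_eq_right_inverse[where B = "\<lambda>i j. B j i", OF I _ B ij])
  fix i m assume im: "i \<in> I" "m \<in> I"
  have "(\<Sum>l\<in>I. B l i * A l m) = (\<Sum>l\<in>I. A m l * B l i)"
    using sym im by (intro sum.cong refl) (simp add: mult.commute)
  thus "(\<Sum>l\<in>I. B l i * A l m) = (if i = m then 1 else 0)" using B[OF im(2,1)] by auto
qed

lemma symmetric_right_inverse_is_inverse_on: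
  assumes I: "finite I"
    and sym: "\<And>i j. i \<in> I \<Longrightarrow> j \<in> I \<Longrightarrow> A i j = A j i"
    and B: "\<And>i j. i \<in> I \<Longrightarrow> j \<in> I \<Longrightarrow> (\<Sum>l\<in>I. A i l * B l j) = (if i = j then 1 else (0::real))"
  shows "is_inverse_on I A B"
proof -
  have "(\<Sum>l\<in>I. B i l * A l j) = (if i = j then 1 else 0)" if "i \<in> I" "j \<in> I" for i j
  proof -
    have "(\<Sum>l\<in>I. B i l * A l j) = (\<Sum>l\<in>I. A j l * B l i)"
      using sym that right_inverse_symmetric[OF I sym B]
      by (intro sum.cong refl) (simp add: mult.commute)
    thus ?thesis using B[OF that(2,1)] by auto
  qed
  thus ?thesis using B by (simp add: is_inverse_on_def)
qed

lemma is_inverse_on_matrix_inv_on: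
  "is_inverse_on I A B \<Longrightarrow> is_inverse_on I A (matrix_inv_on I A)"
  unfolding matrix_inv_on_def by (rule someI[where P = "is_inverse_on I A"])

section \<open>Forest sums as entries of the inverse reduced Laplacian\<close>

locale weighted_graph =
  fixes V :: "'a set" and w :: "'a \<Rightarrow> 'a \<Rightarrow> real"
  assumes finite_V: "finite V"
    and w_sym: "\<And>i j. i \<in> V \<Longrightarrow> j \<in> V \<Longrightarrow> w i j = w j i"
    and w_nonneg: "\<And>i j. i \<in> V \<Longrightarrow> j \<in> V \<Longrightarrow> 0 \<le> w i j"
    and w_diag: "\<And>i. w i i = 0"
begin

abbreviation "L \<equiv> laplacian V w"
abbreviation "F \<equiv> forest_sum V w"
abbreviation "X \<equiv> forest_sum_to V w"

lemma laplacian_sym: "i \<in> V \<Longrightarrow> j \<in> V \<Longrightarrow> L i j = L j i"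
  using w_sym by (simp add: laplacian_def)

lemma laplacian_apply:
  assumes "i \<in> V" shows "(\<Sum>l\<in>V. L i l * x l) = (\<Sum>l\<in>V. w i l) * x i - (\<Sum>l\<in>V. w i l * x l)"
proof -
  have "(\<Sum>l\<in>V. L i l * x l) = (\<Sum>l\<in>V. (if i = l then (\<Sum>l\<in>V. w i l) * x i else 0) - w i l * x l)"
    by (intro sum.cong refl) (auto simp: laplacian_def w_diag)
  thus ?thesis using assms finite_V by (simp add: sum_subtractf sum.delta)
qed

lemma laplacian_const: "i \<in> V \<Longrightarrow> (\<Sum>l\<in>V. L i l * c) = 0"
  using laplacian_apply[of i "\<lambda>_. c"] by (simp add: sum_distrib_right)

text \<open>The diagonal entries are \<open>forest_sum_recurrence\<close>, the others
  \<open>forest_sum_to_harmonic\<close>. The sum extends from \<open>V - S\<close> to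
  \<open>V\<close> because \<open>X S j a\<close> vanishes for \<open>j\<close> in
  \<open>S\<close>.\<close>

lemma laplacian_forest_sum_to:
  assumes "b \<in> V - S" "a \<in> V - S"
  shows "(\<Sum>j\<in>V - S. L b j * X S j a) = (if b = a then F S else 0)"
proof -
  have "(\<Sum>j\<in>V - S. L b j * X S j a) = (\<Sum>j\<in>V. L b j * X S j a)"
    using finite_V assms by (intro sum.mono_neutral_left) (auto simp: forest_sum_to_root)
  also have "\<dots> = (\<Sum>l\<in>V. w b l) * X S b a - (\<Sum>l\<in>V. w b l * X S l a)"
    using assms by (simp add: laplacian_apply)
  also have "\<dots> = (if b = a then F S else 0)"
  proof (cases "b = a")
    case True
    thus ?thesis using forest_sum_recurrence[of V a S w] assms finite_V
      by (simp add: forest_sum_to_self)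
  next
    case False
    thus ?thesis using forest_sum_to_harmonic[of V a b S w] assms finite_V by auto
  qed
  finally show ?thesis .
qed

lemma forest_weight_nonneg:
  assumes "g \<in> forests V S" shows "0 \<le> forest_weight V w S g"
  unfolding forest_weight_def using forests_in[OF assms] w_nonneg by (intro prod_nonneg) auto

lemma forest_sum_to_bounds:
  "0 \<le> X S b a" "X S b a \<le> F (insert a S)"
  unfolding forest_sum_to_def forest_sum_def using forest_weight_nonneg[of _ "insert a S"]
  by (auto intro!: sum_nonneg sum_mono)

text \<open>If \<open>F (insert a S)\<close> were zero, the sums \<open>X S j a\<close> between 0
  and it would vanish too, and the recurrence would give \<open>F S = 0\<close>.\<close>

lemma forest_sum_insert_pos:
  assumes "0 < F S" "a \<in> V - S" shows "0 < F (insert a S)"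
proof (rule ccontr)
  assume "\<not> 0 < F (insert a S)"
  hence "F (insert a S) = 0" "X S j a = 0" for j
    using forest_sum_to_bounds[of S _ a] by (force intro: antisym order_trans)+
  thus False using forest_sum_recurrence[of V a S w] assms finite_V by simp
qed

lemma is_inverse_on_forest_sum_to:
  assumes "0 < F S"
  shows "is_inverse_on (V - S) L (\<lambda>i j. X S i j / F S)"
proof (rule symmetric_right_inverse_is_inverse_on)
  fix i j assume "i \<in> V - S" "j \<in> V - S"
  thus "(\<Sum>l\<in>V - S. L i l * (X S l j / F S)) = (if i = j then 1 else 0)"
    using laplacian_forest_sum_to[of i S j] assms by (simp flip: sum_divide_distrib)
qed (use finite_V laplacian_sym in auto)

text \<open>The symmetry is inherited from the Laplacian through its inverse, in place of a
  bijection that reroots forests.\<close>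

lemma forest_sum_to_sym:
  assumes "0 < F S" "i \<in> V - S" "j \<in> V - S"
  shows "X S i j = X S j i"
proof -
  have "X S i j / F S = X S j i / F S"
    using is_inverse_on_forest_sum_to[OF assms(1)] finite_V laplacian_sym assms(2,3)
    by (intro right_inverse_symmetric[of "V - S" L "\<lambda>i j. X S i j / F S"])
      (auto simp: is_inverse_on_def)
  thus ?thesis using assms by simp
qed

text \<open>Inverting the Laplacian with one more vertex removed is a Schur complement.\<close>

lemma forest_sum_insert_insert:
  assumes F: "0 < F S" and a: "a \<in> V - S" and b: "b \<in> V - S" "a \<noteq> b"
  shows "F (insert b (insert a S)) * F S = X S a a * X S b b - (X S a b)\<^sup>2"
proof -
  let ?S = "insert a S"
  define H where "H i j = (X S i j - X S i a * X S a j / X S a a) / F S" for i j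
  have pos: "0 < X S a a" "0 < F ?S"
    using forest_sum_insert_pos[OF F a] by (simp_all add: forest_sum_to_self)
  have "H b b = X ?S b b / F ?S"
  proof (rule is_inverse_on_unique[where C = H, OF _ is_inverse_on_forest_sum_to[OF pos(2)]])
    fix i j assume i: "i \<in> V - ?S" and j: "j \<in> V - ?S"
    have "(\<Sum>l\<in>V - ?S. L i l * H l j) = (\<Sum>l\<in>V - S. L i l * H l j)"
      \<comment> \<open>The row of \<open>H\<close> at \<open>a\<close> vanishes, so the index
        \<open>a\<close> can be added to the sum.\<close>
      using finite_V pos by (intro sum.mono_neutral_left) (auto simp: H_def)
    also have "\<dots> = ((\<Sum>l\<in>V - S. L i l * X S l j) -
        (\<Sum>l\<in>V - S. L i l * X S l a) * (X S a j / X S a a)) / F S"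
      unfolding sum_distrib_right sum_subtractf[symmetric] sum_divide_distrib
      by (intro sum.cong refl) (simp add: H_def algebra_simps)
    also have "\<dots> = (if i = j then 1 else 0)"
      using i j a F laplacian_forest_sum_to[of i S j] laplacian_forest_sum_to[of i S a] by auto
    finally show "(\<Sum>l\<in>V - ?S. L i l * H l j) = (if i = j then 1 else 0)" .
  qed (use finite_V b in auto)
  moreover have "X S b a = X S a b" using forest_sum_to_sym[OF F] a b by blast
  ultimately have "(X S b b - X S a b * X S a b / X S a a) / F S = F (insert b ?S) / X S a a"
    by (simp add: H_def forest_sum_to_self)
  hence "F (insert b ?S) * F S = X S a a * (X S b b - X S a b * X S a b / X S a a)"
    using pos F by (simp add: frac_eq_eq mult.commute)
  thus ?thesis using pos by (simp add: right_diff_distrib power2_eq_square)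
qed

text \<open>Rows other than \<open>u\<close> come from the inverse. Each column of the Laplacian
  sums to zero, hence so does each column of its product with \<open>Qmat\<close>; this determines
  row \<open>u\<close> and produces the correction there.\<close>

lemma laplacian_Qmat:
  assumes inv: "is_inverse_on (V - {u}) L (matrix_inv_on (V - {u}) L)"
    and u: "u \<in> V" and i: "i \<in> V" and j: "j \<in> V"
  shows "(\<Sum>l\<in>V. L i l * Qmat V w u l j) = of_bool (i = j) - of_bool (i = u)"
proof -
  let ?Q = "Qmat V w u"
  have 1: "(\<Sum>l\<in>V. L i l * ?Q l j) = of_bool (i = j) - of_bool (i = u)"
    if "i \<in> V - {u}" for i
  proof (cases "j = u")
    case True
    thus ?thesis using that by (simp add: Qmat_def)
  next
    case False
    have "(\<Sum>l\<in>V. L i l * ?Q l j) = (\<Sum>l\<in>V - {u}. L i l * matrix_inv_on (V - {u}) L l j)"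
      using finite_V False j by (intro sum.mono_neutral_cong_right) (auto simp: Qmat_def)
    thus ?thesis using inv that False j by (auto simp: is_inverse_on_def)
  qed
  show ?thesis
  proof (cases "i = u")
    case True
    have "(\<Sum>i\<in>V. \<Sum>l\<in>V. L i l * ?Q l j) = (\<Sum>l\<in>V. \<Sum>i\<in>V. L l i * ?Q l j)"
      by (subst sum.swap) (intro sum.cong refl, simp add: laplacian_sym)
    also have "\<dots> = 0" by (simp add: laplacian_const)
    finally have "(\<Sum>l\<in>V. L u l * ?Q l j) = - (\<Sum>i\<in>V - {u}. \<Sum>l\<in>V. L i l * ?Q l j)"
      using finite_V u by (simp add: sum.remove[of V u])
    also have "\<dots> = - (\<Sum>i\<in>V - {u}. if i = j then 1 else 0)"
      by (intro arg_cong[of _ _ uminus] sum.cong refl) (auto simp: 1)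
    also have "\<dots> = of_bool (u = j) - 1"
      using finite_V j by (auto simp: sum.delta)
    finally show ?thesis using True by simp
  next
    case False
    thus ?thesis using 1[of i] i by simp
  qed
qed

text \<open>\<open>M3 Q k\<close> is the inverse of the Laplacian grounded at \<open>k\<close> instead of \<open>u\<close>.\<close>

lemma M3_Qmat:
  assumes F: "0 < F {k}" "0 < F {u}" and u: "u \<in> V" and k: "k \<in> V"
    and l: "l1 \<in> V - {k}" "l2 \<in> V - {k}"
  shows "M3 (Qmat V w u) k l1 l2 = X {k} l1 l2 / F {k}"
proof -
  let ?Q = "Qmat V w u"
  \<comment> \<open>The forest sums supply an inverse, so the choice in \<open>matrix_inv_on\<close>
    is a genuine one.\<close>
  have inv: "is_inverse_on (V - {u}) L (matrix_inv_on (V - {u}) L)"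
    using is_inverse_on_matrix_inv_on[OF is_inverse_on_forest_sum_to[OF F(2)]] .
  have Qsym: "?Q i j = ?Q j i" for i j
    using right_inverse_symmetric[of "V - {u}" L "matrix_inv_on (V - {u}) L" i j]
      inv laplacian_sym finite_V by (auto simp: Qmat_def is_inverse_on_def)
  show ?thesis
  proof (rule is_inverse_on_unique[where C = "M3 ?Q k", OF _ is_inverse_on_forest_sum_to[OF F(1)] _ l])
    fix i j assume i: "i \<in> V - {k}" and j: "j \<in> V - {k}"
    \<comment> \<open>As a function of \<open>l\<close> this is a constant plus column
      \<open>j\<close> minus column \<open>k\<close> of \<open>?Q\<close>. The Laplacian kills the
      constant, and the corrections at \<open>u\<close> cancel in the difference.\<close>
    have M3: "M3 ?Q k l j = (?Q k k - ?Q k j) + ?Q l j - ?Q l k" for l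
      using Qsym[of k l] by (simp add: M3_def)
    \<comment> \<open>The sum extends to \<open>V\<close> because \<open>M3 ?Q k l j\<close>
      vanishes at \<open>l = k\<close>.\<close>
    have "(\<Sum>l\<in>V - {k}. L i l * M3 ?Q k l j) = (\<Sum>l\<in>V. L i l * M3 ?Q k l j)"
      using finite_V by (intro sum.mono_neutral_left) (auto simp: M3)
    also have "\<dots> = (\<Sum>l\<in>V. L i l * (?Q k k - ?Q k j)) + (\<Sum>l\<in>V. L i l * ?Q l j) - (\<Sum>l\<in>V. L i l * ?Q l k)"
      unfolding sum.distrib[symmetric] sum_subtractf[symmetric]
      by (intro sum.cong refl) (simp only: M3 distrib_left right_diff_distrib)
    also have "\<dots> = of_bool (i = j) - of_bool (i = k)"
      using i j k by (simp add: laplacian_const laplacian_Qmat[OF inv u])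
    finally show "(\<Sum>l\<in>V - {k}. L i l * M3 ?Q k l j) = (if i = j then 1 else 0)"
      using i by simp
  qed (use finite_V in auto)
qed

text \<open>\<open>M2\<close> is the diagonal of \<open>M3\<close>, so \<open>Mk\<close> is a 2 by 2
  minor of the inverse grounded at \<open>k\<close>. \<open>forest_sum_insert_insert\<close>
  evaluates it, and one factor \<open>F {k}\<close> cancels.\<close>

lemma Mk_Qmat:
  assumes "0 < F {k}" "0 < F {u}" "u \<in> V" "k \<in> V" "l1 \<in> V - {k}" "l2 \<in> V - {k}" "l1 \<noteq> l2"
  shows "Mk (Qmat V w u) k l1 l2 = F {l2, l1, k} / F {k}"
proof -
  have M2: "M2 (Qmat V w u) k l = X {k} l l / F {k}" if "l \<in> V - {k}" for l
    using M3_Qmat[OF assms(1-4) that that] by (simp add: M2_def M3_def)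
  have Mk: "Mk (Qmat V w u) k l1 l2 = (X {k} l1 l1 * X {k} l2 l2 - (X {k} l1 l2)\<^sup>2) / (F {k})\<^sup>2"
    unfolding Mk_def M2[OF assms(5)] M2[OF assms(6)] M3_Qmat[OF assms(1-6)]
    using assms(1) by (simp add: field_simps power2_eq_square)
  show ?thesis
    unfolding Mk forest_sum_insert_insert[OF assms(1,5,6,7), symmetric]
    using assms(1) by (simp add: power2_eq_square)
qed

end

section \<open>Spanning trees as parent functions\<close>

text \<open>A walk that returns to one of its vertices is cut back to that vertex, which keeps the
  list distinct as \<open>graph_cycle\<close> requires.\<close>

lemma rtrancl_edges_distinct_path:
  assumes "(a, b) \<in> {(x, y). {x, y} \<in> E}\<^sup>*"
  shows "\<exists>xs. xs \<noteq> [] \<and> distinct xs \<and> hd xs = a \<and> last xs = b \<and>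
    (\<forall>i. Suc i < length xs \<longrightarrow> {xs ! i, xs ! Suc i} \<in> E)"
  using assms
proof (induction rule: rtrancl_induct)
  case base
  show ?case by (intro exI[of _ "[a]"]) simp
next
  case (step b c)
  then obtain xs where xs: "xs \<noteq> []" "distinct xs" "hd xs = a" "last xs = b"
    and adj: "\<And>i. Suc i < length xs \<Longrightarrow> {xs ! i, xs ! Suc i} \<in> E" by blast
  show ?case
  proof (cases "c \<in> set xs")
    case True
    then obtain n where n: "n < length xs" "xs ! n = c" by (auto simp: in_set_conv_nth)
    hence "last (take (Suc n) xs) = c" by (simp add: take_Suc_conv_app_nth)
    thus ?thesis using xs adj n by (intro exI[of _ "take (Suc n) xs"]) auto
  next
    case False
    have "{(xs @ [c]) ! i, (xs @ [c]) ! Suc i} \<in> E" if "Suc i < length (xs @ [c])" for i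
    proof (cases "Suc i < length xs")
      case True
      thus ?thesis using adj[of i] by (simp add: nth_append)
    next
      case False
      hence "i = length xs - 1" using that by simp
      hence "(xs @ [c]) ! i = b" "(xs @ [c]) ! Suc i = c"
        using xs by (simp_all add: nth_append last_conv_nth)
      thus ?thesis using step.hyps by simp
    qed
    thus ?thesis using xs False by (intro exI[of _ "xs @ [c]"]) auto
  qed
qed

definition parent_edges :: "'a set \<Rightarrow> 'a \<Rightarrow> ('a \<Rightarrow> 'a) \<Rightarrow> 'a set set" where
  "parent_edges V k g = (\<lambda>i. {i, g i}) ` (V - {k})"

lemma forest_depth:
  assumes "g \<in> forests V S"
  shows "\<exists>d :: 'a \<Rightarrow> nat. \<forall>i\<in>V - S. d (g i) < d i"
proof -
  obtain d :: "'a \<Rightarrow> nat" where d: "\<And>i r. leads S g i r \<Longrightarrow> i \<notin> S \<Longrightarrow> d (g i) < d i"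
    using leads_decreasing[of S g] by blast
  have "d (g i) < d i" if "i \<in> V - S" for i
    using forests_leads[OF assms, of i] d that by blast
  thus ?thesis by blast
qed

text \<open>Two vertices with the same edge would be each other's parent, against the strict
  decrease of depth.\<close>

lemma inj_on_parent_edge:
  assumes "g \<in> forests V {k}" shows "inj_on (\<lambda>i. {i, g i}) (V - {k})"
proof (rule inj_onI, rule ccontr)
  obtain d :: "_ \<Rightarrow> nat" where d: "\<And>i. i \<in> V - {k} \<Longrightarrow> d (g i) < d i"
    using forest_depth[OF assms] by blast
  fix i j assume ij: "i \<in> V - {k}" "j \<in> V - {k}" "{i, g i} = {j, g j}" "i \<noteq> j"
  hence "g i = j" "g j = i" by (auto simp: doubleton_eq_iff)
  thus False using d[OF ij(1)] d[OF ij(2)] by simp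
qed

lemma parent_edges_subset_all_edges:
  assumes "g \<in> forests V {k}" shows "parent_edges V k g \<subseteq> all_edges V"
proof -
  obtain d :: "_ \<Rightarrow> nat" where d: "\<And>i. i \<in> V - {k} \<Longrightarrow> d (g i) < d i"
    using forest_depth[OF assms] by blast
  have "g i \<noteq> i \<and> g i \<in> V" if "i \<in> V - {k}" for i
    using d[OF that] forests_in[OF assms] that by auto
  thus ?thesis by (force simp: parent_edges_def all_edges_def)
qed

lemma graph_connected_parent_edges:
  assumes "g \<in> forests V {k}" "k \<in> V" shows "graph_connected V (parent_edges V k g)"
proof -
  let ?R = "{(a, b). {a, b} \<in> parent_edges V k g}"
  have "sym ?R" by (auto simp: sym_def insert_commute)
  hence symR: "sym (?R\<^sup>*)" by (rule sym_rtrancl)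
  have to_k: "(i, k) \<in> ?R\<^sup>*" if i: "i \<in> V" for i
  proof -
    obtain r where "leads {k} g i r" using forests_leads[OF assms(1) i] ..
    thus ?thesis using i
    proof (induction rule: leads.induct)
      case (step i r)
      have "(i, g i) \<in> ?R" using step.hyps step.prems by (auto simp: parent_edges_def)
      moreover have "g i \<in> V" using forests_in[OF assms(1)] step by auto
      ultimately show ?case using step.IH by (meson converse_rtrancl_into_rtrancl)
    qed auto
  qed
  show ?thesis unfolding graph_connected_def
    using to_k symD[OF symR] by (meson rtrancl_trans)
qed

text \<open>
  At a vertex of maximal depth on a cycle, both neighbours on the cycle would be its parent.
\<close>

lemma graph_acyclic_parent_edges:
  assumes "g \<in> forests V {k}" shows "graph_acyclic (parent_edges V k g)"
  unfolding graph_acyclic_def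
proof
  assume "\<exists>c. graph_cycle (parent_edges V k g) c"
  then obtain c where len: "length c \<ge> 3" and dist: "distinct c"
    and adj: "\<And>i. i < length c \<Longrightarrow> {c ! i, c ! (Suc i mod length c)} \<in> parent_edges V k g"
    by (auto simp: graph_cycle_def)
  obtain d :: "_ \<Rightarrow> nat" where d: "\<And>i. i \<in> V - {k} \<Longrightarrow> d (g i) < d i"
    using forest_depth[OF assms] by blast
  let ?n = "length c"
  obtain m where m: "m < ?n" and max: "\<And>i. i < ?n \<Longrightarrow> d (c ! i) \<le> d (c ! m)"
  proof -
    have fin: "finite ((\<lambda>i. d (c ! i)) ` {..<?n})" and ne: "(\<lambda>i. d (c ! i)) ` {..<?n} \<noteq> {}"
      using len by (auto simp: lessThan_empty_iff)
    from Max_in[OF fin ne] obtain m where "m < ?n" "Max ((\<lambda>i. d (c ! i)) ` {..<?n}) = d (c ! m)"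
      by auto
    moreover have "d (c ! i) \<le> Max ((\<lambda>i. d (c ! i)) ` {..<?n})" if "i < ?n" for i
      using fin that by (intro Max_ge) auto
    ultimately show ?thesis using that by metis
  qed
  \<comment> \<open>Every edge joins a vertex to its strictly less deep parent, so a neighbour that
    is not deeper than \<open>c ! m\<close> cannot be its child.\<close>
  have parent: "x = g (c ! m)" if x: "{c ! m, x} \<in> parent_edges V k g" "d x \<le> d (c ! m)" for x
  proof -
    obtain i where i: "i \<in> V - {k}" "{c ! m, x} = {i, g i}" using x(1) by (auto simp: parent_edges_def)
    thus ?thesis using d[OF i(1)] x(2) by (auto simp: doubleton_eq_iff)
  qed
  define p where "p = (if m = 0 then ?n - 1 else m - 1)"
  have p: "p < ?n" "Suc p mod ?n = m" using m by (auto simp: p_def)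
  let ?q = "Suc m mod ?n"
  have q: "?q < ?n" using m by (intro mod_less_divisor) linarith
  have "c ! ?q = g (c ! m)" using adj[OF m] max q by (intro parent) auto
  moreover have "c ! p = g (c ! m)"
    using adj[OF p(1)] p max by (intro parent) (auto simp: insert_commute)
  \<comment> \<open>The indices before and after \<open>m\<close> coincide only on a cycle of length
    at most 2.\<close>
  ultimately have "?q = p" using nth_eq_iff_index_eq[OF dist q p(1)] by metis
  thus False using len m by (cases "Suc m = ?n") (auto simp: p_def split: if_splits)
qed

text \<open>Induction on the depth in \<open>f\<close>: if \<open>{i, f i}\<close> were the edge of
  \<open>f i\<close> in \<open>g\<close>, then \<open>g (f i) = i\<close>, and the induction
  hypothesis would give \<open>f (f i) = i\<close>, against the decrease of depth.\<close>

lemma inj_on_parent_edges: "inj_on (parent_edges V k) (forests V {k})"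
proof (rule inj_onI)
  fix f g assume f: "f \<in> forests V {k}" and g: "g \<in> forests V {k}"
    and eq: "parent_edges V k f = parent_edges V k g"
  obtain d :: "_ \<Rightarrow> nat" where d: "\<And>i. i \<in> V - {k} \<Longrightarrow> d (f i) < d i"
    using forest_depth[OF f] by blast
  have "f i = g i" if "i \<in> V - {k}" for i
    using that
  proof (induction "d i" arbitrary: i rule: less_induct)
    case less
    have "{i, f i} \<in> parent_edges V k g" using less.prems eq by (auto simp: parent_edges_def)
    then obtain j where j: "j \<in> V - {k}" "{i, f i} = {j, g j}" by (auto simp: parent_edges_def)
    show ?case
    proof (cases "j = i")
      case True
      thus ?thesis using j by (auto simp: doubleton_eq_iff)
    next
      case False
      hence ji: "j = f i" "g j = i" using j by (auto simp: doubleton_eq_iff)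
      hence "f j = i" using less.hyps[of j] d[OF less.prems] j by simp
      thus ?thesis using d[OF less.prems] d[OF j(1)] ji by simp
    qed
  qed
  moreover have "f i = g i" if "i \<notin> V - {k}" for i
    using f g that by (auto simp: forests_def PiE_def extensional_def)
  ultimately show "f = g" by blast
qed

text \<open>Each vertex other than \<open>k\<close> takes as parent a neighbour closer to
  \<open>k\<close>. Any further edge of the tree would close a cycle with a path of parent
  edges.\<close>

lemma spanning_tree_parent_edges:
  assumes T: "T \<in> spanning_trees V" and k: "k \<in> V"
  shows "\<exists>g\<in>forests V {k}. parent_edges V k g = T"
proof -
  have sub: "T \<subseteq> all_edges V" and con: "graph_connected V T" and acy: "graph_acyclic T"
    using T by (auto simp: spanning_trees_def)
  define R where "R = {(a, b). {a, b} \<in> T}"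
  \<comment> \<open>The graph distance from \<open>i\<close> to \<open>k\<close> in
    \<open>T\<close>.\<close>
  define d where "d i = (LEAST n. (i, k) \<in> R ^^ n)" for i
  have edgeV: "i \<in> V \<and> x \<in> V" if "{i, x} \<in> T" for i x
    using that sub by (auto simp: all_edges_def doubleton_eq_iff)
  have "\<exists>x. {i, x} \<in> T \<and> d x < d i" if i: "i \<in> V - {k}" for i
  proof -
    have "(i, k) \<in> R\<^sup>*" using con i k by (auto simp: graph_connected_def R_def)
    hence "\<exists>n. (i, k) \<in> R ^^ n" by (rule rtrancl_imp_relpow)
    hence di: "(i, k) \<in> R ^^ d i" unfolding d_def by (rule LeastI_ex)
    with i obtain m where m: "d i = Suc m" by (cases "d i") auto
    with di obtain x where x: "(i, x) \<in> R" "(x, k) \<in> R ^^ m" by (metis relpow_Suc_E2)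
    have "d x \<le> m" unfolding d_def using x(2) by (rule Least_le)
    thus ?thesis using x m by (auto simp: R_def)
  qed
  then obtain h where h: "\<And>i. i \<in> V - {k} \<Longrightarrow> {i, h i} \<in> T \<and> d (h i) < d i" by metis
  define g where "g = restrict h (V - {k})"
  have g: "{i, g i} \<in> T" "d (g i) < d i" if "i \<in> V - {k}" for i
    using h[OF that] that by (auto simp: g_def)
  have gV: "g i \<in> V" if "i \<in> V - {k}" for i using g(1)[OF that] edgeV by blast
  have "leads {k} g i k" if "i \<in> V" for i
    using that
  proof (induction "d i" arbitrary: i rule: less_induct)
    case less
    show ?case
    proof (cases "i = k")
      case True
      thus ?thesis by (auto intro: leads.root)
    next
      case False
      thus ?thesis using less.hyps[of "g i"] g(2)[of i] gV[of i] less.prems by (auto intro: leads.step)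
    qed
  qed
  moreover have "g \<in> (V - {k}) \<rightarrow>\<^sub>E V" using gV by (auto simp: g_def)
  ultimately have gF: "g \<in> forests V {k}" by (auto simp: forests_def)
  have subT: "parent_edges V k g \<subseteq> T" using g(1) by (auto simp: parent_edges_def)
  have "e \<in> parent_edges V k g" if e: "e \<in> T" for e
  proof (rule ccontr)
    assume ne: "e \<notin> parent_edges V k g"
    obtain a b where ab: "e = {a, b}" "a \<in> V" "b \<in> V" "a \<noteq> b"
      using e sub by (auto simp: all_edges_def)
    have "(a, b) \<in> {(x, y). {x, y} \<in> parent_edges V k g}\<^sup>*"
      using graph_connected_parent_edges[OF gF k] ab by (auto simp: graph_connected_def)
    then obtain xs where xs: "xs \<noteq> []" "distinct xs" "hd xs = a" "last xs = b"
      and adj: "\<And>i. Suc i < length xs \<Longrightarrow> {xs ! i, xs ! Suc i} \<in> parent_edges V k g"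
      using rtrancl_edges_distinct_path by metis
    have ends: "xs ! 0 = a" "xs ! (length xs - 1) = b"
      using xs by (simp_all add: hd_conv_nth last_conv_nth)
    \<comment> \<open>A cycle needs three vertices: with a single vertex the ends would coincide,
      and with two the edge \<open>e\<close> would itself be a parent edge.\<close>
    have "length xs \<noteq> 0" "length xs \<noteq> 1" using ends ab(4) xs(1) by auto
    moreover have "length xs \<noteq> 2" using ends adj[of 0] ne ab(1) by auto
    ultimately have len: "length xs \<ge> 3" by linarith
    have "{xs ! i, xs ! (Suc i mod length xs)} \<in> T" if "i < length xs" for i
    proof (cases "Suc i < length xs")
      case True
      thus ?thesis using adj[of i] subT by auto
    next
      case False
      hence "Suc i = length xs" using that by simp
      moreover from this have "i = length xs - 1" by simp
      ultimately have "xs ! i = b" "xs ! (Suc i mod length xs) = a" using ends by simp_all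
      thus ?thesis using e ab(1) by (simp add: insert_commute)
    qed
    hence "graph_cycle T xs" using len xs(2) by (simp add: graph_cycle_def)
    thus False using acy by (auto simp: graph_acyclic_def)
  qed
  thus ?thesis using gF subT by blast
qed

lemma bij_betw_parent_edges:
  assumes "k \<in> V" shows "bij_betw (parent_edges V k) (forests V {k}) (spanning_trees V)"
  unfolding bij_betw_def
proof (intro conjI inj_on_parent_edges equalityI subsetI)
  fix T assume "T \<in> parent_edges V k ` forests V {k}"
  thus "T \<in> spanning_trees V"
    using assms parent_edges_subset_all_edges graph_connected_parent_edges graph_acyclic_parent_edges
    by (fastforce simp: spanning_trees_def)
next
  fix T assume "T \<in> spanning_trees V"
  thus "T \<in> parent_edges V k ` forests V {k}"
    using spanning_tree_parent_edges[OF _ assms] by blast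
qed

lemma vertex_degree_parent_edges:
  assumes "g \<in> forests V {k}"
  shows "vertex_degree (parent_edges V k g) k = card {l \<in> V - {k}. g l = k}"
proof -
  have "{e \<in> parent_edges V k g. k \<in> e} = (\<lambda>i. {i, g i}) ` {l \<in> V - {k}. g l = k}"
    by (auto simp: parent_edges_def)
  moreover have "inj_on (\<lambda>i. {i, g i}) {l \<in> V - {k}. g l = k}"
    by (rule inj_on_subset[OF inj_on_parent_edge[OF assms]]) auto
  ultimately show ?thesis by (simp only: vertex_degree_def card_image)
qed

lemma edge_prod_parent_edges:
  fixes w :: "'a::linorder \<Rightarrow> 'a \<Rightarrow> real"
  assumes g: "g \<in> forests V {k}" and sym: "\<And>i j. i \<in> V \<Longrightarrow> j \<in> V \<Longrightarrow> w i j = w j i"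
  shows "edge_prod w (parent_edges V k g) = forest_weight V w {k} g"
proof -
  have "edge_prod w (parent_edges V k g) = (\<Prod>i\<in>V - {k}. w (Min {i, g i}) (Max {i, g i}))"
    unfolding edge_prod_def parent_edges_def
    by (subst prod.reindex[OF inj_on_parent_edge[OF g]]) (simp add: o_def)
  also have "\<dots> = forest_weight V w {k} g"
    unfolding forest_weight_def
  proof (intro prod.cong refl)
    fix i assume i: "i \<in> V - {k}"
    hence "w i (g i) = w (g i) i" using forests_in[OF g] by (intro sym) auto
    thus "w (Min {i, g i}) (Max {i, g i}) = w i (g i)" by (simp add: min_def max_def)
  qed
  finally show ?thesis .
qed

section \<open>The variance of the degree\<close>

text \<open>The test function \<phi> covers both the normalising constant, with the constant 1, and
  all expectations.\<close>

lemma sum_spanning_trees: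
  fixes w :: "'a::linorder \<Rightarrow> 'a \<Rightarrow> real"
  assumes "k \<in> V" and sym: "\<And>i j. i \<in> V \<Longrightarrow> j \<in> V \<Longrightarrow> w i j = w j i"
  shows "(\<Sum>T\<in>spanning_trees V. edge_prod w T * \<phi> T) =
    (\<Sum>g\<in>forests V {k}. forest_weight V w {k} g * \<phi> (parent_edges V k g))"
  unfolding sum.reindex_bij_betw[OF bij_betw_parent_edges[OF assms(1)], symmetric]
  by (intro sum.cong refl) (simp add: edge_prod_parent_edges sym)

context weighted_graph
begin

text \<open>Both cut edges end in the root \<open>k\<close>, so
  \<open>sum_forests_fixed_parent\<close> applies twice and no cycle condition is left.\<close>

lemma sum_forests_two_neighbours:
  assumes "k \<in> V" "l1 \<in> V - {k}" "l2 \<in> V - {k}" "l1 \<noteq> l2"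
  shows "(\<Sum>g\<in>forests V {k}. forest_weight V w {k} g * (of_bool (g l1 = k) * of_bool (g l2 = k))) =
    w k l1 * w k l2 * F {l2, l1, k}"
proof -
  have "(\<Sum>g\<in>forests V {k}. forest_weight V w {k} g * (of_bool (g l1 = k) * of_bool (g l2 = k))) =
      (\<Sum>g\<in>forests V {k}. of_bool (g l1 = k) * (of_bool (g l2 = k) * forest_weight V w {k} g))"
    by (simp only: mult_ac)
  also have "\<dots> = (\<Sum>g\<in>forests V {l1, k}. of_bool (g l2 = k) * (w l1 k * forest_weight V w {l1, k} g))"
    using assms finite_V by (subst sum_forests_fixed_parent) (auto simp: forest_weight_extend)
  also have "\<dots> = (\<Sum>g\<in>forests V {l2, l1, k}. w l1 k * (w l2 k * forest_weight V w {l2, l1, k} g))"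
    using assms finite_V by (subst sum_forests_fixed_parent) (auto simp: forest_weight_extend)
  also have "\<dots> = w k l1 * w k l2 * F {l2, l1, k}"
    using assms w_sym by (simp add: forest_sum_def sum_distrib_left mult.assoc)
  finally show ?thesis .
qed

end

text \<open>The degree is a sum of 0-1 indicators. In its square the diagonal terms are the
  indicators again and give back the degree.\<close>

lemma vertex_degree_square:
  assumes "finite V" "g \<in> forests V {k}"
  shows "(real (vertex_degree (parent_edges V k g) k))\<^sup>2 = real (vertex_degree (parent_edges V k g) k) +
    (\<Sum>(l1, l2) \<in> {(l1, l2). l1 \<in> V - {k} \<and> l2 \<in> V - {k} \<and> l1 \<noteq> l2}.
        of_bool (g l1 = k) * of_bool (g l2 = k))"
proof -
  let ?U = "V - {k}"
  let ?b = "\<lambda>l. of_bool (g l = k) :: real"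
  have deg: "real (vertex_degree (parent_edges V k g) k) = (\<Sum>l\<in>?U. ?b l)"
    using assms by (simp add: vertex_degree_parent_edges sum_of_bool_eq Int_def)
  have "(\<Sum>l\<in>?U. ?b l)\<^sup>2 = (\<Sum>(l1, l2)\<in>?U \<times> ?U. ?b l1 * ?b l2)"
    by (simp only: power2_eq_square sum_product sum.cartesian_product)
  also have "?U \<times> ?U = (\<lambda>l. (l, l)) ` ?U \<union> {(l1, l2). l1 \<in> ?U \<and> l2 \<in> ?U \<and> l1 \<noteq> l2}"
    by auto
  also have "(\<Sum>(l1, l2)\<in>\<dots>. ?b l1 * ?b l2) = (\<Sum>(l1, l2)\<in>(\<lambda>l. (l, l)) ` ?U. ?b l1 * ?b l2) +
      (\<Sum>(l1, l2)\<in>{(l1, l2). l1 \<in> ?U \<and> l2 \<in> ?U \<and> l1 \<noteq> l2}. ?b l1 * ?b l2)"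
    using assms(1)
    by (intro sum.union_disjoint) (auto intro: finite_subset[of _ "?U \<times> ?U"])
  also have "(\<Sum>(l1, l2)\<in>(\<lambda>l. (l, l)) ` ?U. ?b l1 * ?b l2) = (\<Sum>l\<in>?U. ?b l)"
    by (subst sum.reindex) (auto simp: inj_on_def intro!: sum.cong)
  finally show ?thesis unfolding deg .
qed

theorem theorem4:
  fixes p :: nat and V :: "nat set"
    and \<beta> :: "nat \<Rightarrow> nat \<Rightarrow> real"
    and pD :: "nat \<Rightarrow> real" and pDD :: "nat \<Rightarrow> nat \<Rightarrow> real"
    and \<omega> :: "nat \<Rightarrow> nat \<Rightarrow> real" and Q :: "nat \<Rightarrow> nat \<Rightarrow> real"
    and E Var :: "nat \<Rightarrow> real" and u k :: nat
  defines "V \<equiv> {1..p}"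
    and "\<omega> \<equiv> posterior_weight \<beta> pD pDD"
    and "Q \<equiv> Qmat V \<omega> u"
    and "E \<equiv> (\<lambda>k. measure_pmf.expectation (posterior_tree V \<beta> pD pDD)
                       (\<lambda>T. real (vertex_degree T k)))"
    and "Var \<equiv> (\<lambda>k. measure_pmf.variance (posterior_tree V \<beta> pD pDD)
                         (\<lambda>T. real (vertex_degree T k)))"
  assumes "\<forall>i\<in>V. \<forall>j\<in>V. \<beta> i j = \<beta> j i"
    and "\<forall>i\<in>V. \<forall>j\<in>V. \<beta> i j \<ge> 0"
    and "graph_connected V {{i, j} | i j. i \<in> V \<and> j \<in> V \<and> i \<noteq> j \<and> \<beta> i j > 0}"
    and "\<forall>i\<in>V. pD i > 0"
    and "\<forall>i\<in>V. \<forall>j\<in>V. i \<noteq> j \<longrightarrow> pDD i j > 0"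
    and "\<forall>i\<in>V. \<forall>j\<in>V. i \<noteq> j \<longrightarrow> pDD i j = pDD j i"
    and "u \<in> V" and "k \<in> V"
  shows "Var k = E k * (1 - E k) +
    (\<Sum>(l1, l2) \<in> {(l1, l2). l1 \<in> V - {k} \<and> l2 \<in> V - {k} \<and> l1 \<noteq> l2}.
        \<omega> k l1 * \<omega> k l2 * Mk Q k l1 l2)"
proof -
  define N where "N T = real (vertex_degree T k)" for T :: "nat set set"
  define M where "M = posterior_tree V \<beta> pD pDD"
  define Z where "Z = (\<Sum>T\<in>spanning_trees V. edge_prod \<omega> T)"
  let ?P = "{(l1, l2). l1 \<in> V - {k} \<and> l2 \<in> V - {k} \<and> l1 \<noteq> l2}"
  let ?x = "forest_weight V \<omega> {k}"
  have fin: "finite V" by (simp add: V_def)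
  note hyps = fin assms(6-10)
  interpret weighted_graph V \<omega>
  proof
    fix i j assume ij: "i \<in> V" "j \<in> V"
    show "\<omega> i j = \<omega> j i"
      using assms(6,11) ij by (auto simp: \<omega>_def posterior_weight_def mult.commute)
    show "0 \<le> \<omega> i j"
      using assms(7,9,10) ij by (auto simp: \<omega>_def posterior_weight_def less_imp_le)
  qed (auto simp: fin \<omega>_def posterior_weight_def)
  \<comment> \<open>The tree sum does not depend on the root, so \<open>F {k}\<close> and
    \<open>F {u}\<close> are the same constant.\<close>
  have F: "F {v} = Z" if "v \<in> V" for v
    using sum_spanning_trees[where \<phi> = "\<lambda>_. 1", OF that w_sym] by (simp add: Z_def forest_sum_def)
  have Z: "0 < Z" unfolding Z_def \<omega>_def by (rule sum_edge_prod_pos(2)[OF hyps])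
  have pmf: "pmf M T = (if T \<in> spanning_trees V then edge_prod \<omega> T / Z else 0)" for T
    unfolding M_def pmf_posterior_tree[OF hyps]
    using tree_posterior_eq[OF hyps, of T] by (simp add: Z_def \<omega>_def)
  have supp: "set_pmf M \<subseteq> spanning_trees V" by (auto simp: set_pmf_eq pmf split: if_splits)
  have finM: "finite (set_pmf M)" using finite_subset[OF supp finite_spanning_trees[OF fin]] .
  have Ex: "measure_pmf.expectation M f = (\<Sum>g\<in>forests V {k}. ?x g * f (parent_edges V k g)) / Z"
    for f :: "nat set set \<Rightarrow> real"
  proof -
    have "measure_pmf.expectation M f = (\<Sum>T\<in>spanning_trees V. f T * pmf M T)"
      using supp finite_spanning_trees[OF fin] by (intro integral_measure_pmf_real) auto
    also have "\<dots> = (\<Sum>T\<in>spanning_trees V. edge_prod \<omega> T * f T) / Z"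
      unfolding sum_divide_distrib by (intro sum.cong refl) (simp add: pmf)
    also have "(\<Sum>T\<in>spanning_trees V. edge_prod \<omega> T * f T) =
        (\<Sum>g\<in>forests V {k}. ?x g * f (parent_edges V k g))"
      by (rule sum_spanning_trees[OF \<open>k \<in> V\<close> w_sym])
    finally show ?thesis .
  qed
  have E: "E k = measure_pmf.expectation M N" by (simp add: E_def M_def N_def[abs_def])
  have "Var k = measure_pmf.variance M N" by (simp add: Var_def M_def N_def[abs_def])
  also have "\<dots> = measure_pmf.expectation M (\<lambda>T. (N T)\<^sup>2) - (E k)\<^sup>2"
    unfolding E by (intro measure_pmf.variance_eq integrable_measure_pmf_finite finM)
  \<comment> \<open>The linear term \<open>E k\<close> combines with the subtracted square of the
    mean to give \<open>E k * (1 - E k)\<close>.\<close>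
  also have "measure_pmf.expectation M (\<lambda>T. (N T)\<^sup>2) = E k +
      (\<Sum>g\<in>forests V {k}. ?x g * (\<Sum>(l1, l2)\<in>?P. of_bool (g l1 = k) * of_bool (g l2 = k))) / Z"
    unfolding E Ex add_divide_distrib[symmetric] sum.distrib[symmetric]
    using vertex_degree_square[OF fin, of _ k]
    by (intro arg_cong[of _ _ "\<lambda>s. s / Z"] sum.cong refl) (simp add: N_def distrib_left)
  also have "(\<Sum>g\<in>forests V {k}. ?x g * (\<Sum>(l1, l2)\<in>?P. of_bool (g l1 = k) * of_bool (g l2 = k))) / Z =
      (\<Sum>(l1, l2)\<in>?P. (\<Sum>g\<in>forests V {k}. ?x g * (of_bool (g l1 = k) * of_bool (g l2 = k))) / Z)"
    unfolding sum_distrib_left sum_divide_distrib case_prod_unfold by (rule sum.swap)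
  also have "\<dots> = (\<Sum>(l1, l2)\<in>?P. \<omega> k l1 * \<omega> k l2 * Mk Q k l1 l2)"
  proof (intro sum.cong refl)
    fix x assume "x \<in> ?P"
    then obtain l1 l2 where x: "x = (l1, l2)"
      and l: "l1 \<in> V" "l1 \<noteq> k" "l2 \<in> V" "l2 \<noteq> k" "l1 \<noteq> l2" by auto
    have "Mk Q k l1 l2 = F {l2, l1, k} / Z"
      using Mk_Qmat[of k u l1 l2] F Z l \<open>u \<in> V\<close> \<open>k \<in> V\<close> by (simp add: Q_def)
    moreover have "(\<Sum>g\<in>forests V {k}. ?x g * (of_bool (g l1 = k) * of_bool (g l2 = k))) =
        \<omega> k l1 * \<omega> k l2 * F {l2, l1, k}"
      using l \<open>k \<in> V\<close> by (intro sum_forests_two_neighbours) auto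
    ultimately show "(case x of (l1, l2) \<Rightarrow>
          (\<Sum>g\<in>forests V {k}. ?x g * (of_bool (g l1 = k) * of_bool (g l2 = k))) / Z) =
        (case x of (l1, l2) \<Rightarrow> \<omega> k l1 * \<omega> k l2 * Mk Q k l1 l2)" by (simp add: x)
  qed
  finally show ?thesis by (simp add: power2_eq_square right_diff_distrib)
qed

end
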